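(* Let $\pi$ be a semigroup, let $A=(\{A_\varphi\}_{\varphi\in\pi},\{\mu_{p,q}\}_{p,q\in\pi})$ be a T-algebra over $K$, and let $R=\{R_\varphi:A_\varphi\to A_\varphi\}_{\varphi\in\pi}$ be a family of linear maps. Let $\lambda\in K$ with $\lambda\neq 0$, and assume that $\lambda$ has no zero divisor in $\{A_\varphi\}_{\varphi\in\pi}$, meaning that if $c\in A_\varphi$ satisfies $\lambda c=0$, then $c=0$. Define $\tilde R_\varphi=-\lambda\,\mathrm{id}_{A_\varphi}-R_\varphi$ for all $\varphi\in\pi$. Then $(A,R)$ is a Rota-Baxter T-algebra of weight $\lambda$ if and only if for all $p,q\in\pi$, $a\in A_p$, $b\in A_q$ there is an element $c\in A_{pq}$ such that $$R_p(a)\cdot_{p,q}R_q(b)=R_{pq}(c)\quad\text{and}\quad \tilde R_p(a)\cdot_{p,q}\tilde R_q(b)=-\tilde R_{pq}(c).$$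
   Context: $K$ is a field; all vector spaces, tensor products and linear maps are over $K$. For a semigroup $\pi$, a T-algebra is a family of vector spaces $\{A_\varphi\}_{\varphi\in\pi}$ with linear maps $\mu_{p,q}:A_p\otimes A_q\to A_{pq}$ ($p,q\in\pi$), written $\mu_{p,q}(a\otimes b)=a\cdot_{p,q}b$, such that $(a\cdot_{p,q}b)\cdot_{pq,t}c=a\cdot_{p,qt}(b\cdot_{q,t}c)$ for all $p,q,t\in\pi$, $a\in A_p,b\in A_q,c\in A_t$. A Rota-Baxter T-algebra of weight $\lambda\in K$, denoted $(A,R)$, is a T-algebra $A$ with a family of linear maps $R=\{R_\varphi:A_\varphi\to A_\varphi\}_{\varphi\in\pi}$ such that $R_p(a)\cdot_{p,q}R_q(b)=R_{pq}\big(R_p(a)\cdot_{p,q}b+a\cdot_{p,q}R_q(b)+\lambda\, a\cdot_{p,q}b\big)$ for all $p,q\in\pi$, $a\in A_p$, $b\in A_q$. *)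

theory Defs
  imports "HOL-Algebra.Module"
begin

text \<open>
  A vector space over the field \<open>K\<close> is a \<^locale>\<open>module\<close> over \<open>K\<close>. Of the \<open>module\<close> record only the
  carrier, the additive structure and the scalar multiplication are used; the ring fields
  \<open>mult\<close> and \<open>one\<close>, which the record type inherits, are unconstrained.
\<close>

definition linear_map ::
  "('k, 'm) ring_scheme \<Rightarrow> ('k, 'v, 'n) module_scheme \<Rightarrow> ('k, 'w, 'l) module_scheme
    \<Rightarrow> ('v \<Rightarrow> 'w) \<Rightarrow> bool" where
  "linear_map K V W f \<longleftrightarrow>
     f \<in> carrier V \<rightarrow> carrier W \<and>
     (\<forall>x\<in>carrier V. \<forall>y\<in>carrier V. f (x \<oplus>\<^bsub>V\<^esub> y) = f x \<oplus>\<^bsub>W\<^esub> f y) \<and>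
     (\<forall>k\<in>carrier K. \<forall>x\<in>carrier V. f (k \<odot>\<^bsub>V\<^esub> x) = k \<odot>\<^bsub>W\<^esub> f x)"

text \<open>
  Linear maps \<open>U \<otimes> V \<rightarrow> W\<close> are given, via the universal property of the tensor product, by
  bilinear maps: \<open>f a b\<close> is the value on \<open>a \<otimes> b\<close>.
\<close>

definition bilinear_map ::
  "('k, 'm) ring_scheme \<Rightarrow> ('k, 'u, 'n) module_scheme \<Rightarrow> ('k, 'v, 'l) module_scheme
    \<Rightarrow> ('k, 'w, 'j) module_scheme \<Rightarrow> ('u \<Rightarrow> 'v \<Rightarrow> 'w) \<Rightarrow> bool" where
  "bilinear_map K U V W f \<longleftrightarrow>
     (\<forall>a\<in>carrier U. linear_map K V W (\<lambda>b. f a b)) \<and>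
     (\<forall>b\<in>carrier V. linear_map K U W (\<lambda>a. f a b))"

text \<open>
  The components \<open>A p\<close> share one element type, but each has its own carrier and its own operations,
  and no relation between different components is assumed.
\<close>

locale T_algebra = K?: field K for K :: "('k, 'm) ring_scheme" (structure) +
  fixes A :: "'p::semigroup_mult \<Rightarrow> ('k, 'v, 'n) module_scheme"
    and \<mu> :: "'p \<Rightarrow> 'p \<Rightarrow> 'v \<Rightarrow> 'v \<Rightarrow> 'v"
  assumes vector_space_component: "module K (A p)"
    and \<mu>_bilinear: "bilinear_map K (A p) (A q) (A (p * q)) (\<mu> p q)"
    and \<mu>_assoc: "\<lbrakk>a \<in> carrier (A p); b \<in> carrier (A q); c \<in> carrier (A t)\<rbrakk>
      \<Longrightarrow> \<mu> (p * q) t (\<mu> p q a b) c = \<mu> p (q * t) a (\<mu> q t b c)"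

locale Rota_Baxter_T_algebra = T_algebra K A \<mu>
  for K :: "('k, 'm) ring_scheme" (structure)
    and A :: "'p::semigroup_mult \<Rightarrow> ('k, 'v, 'n) module_scheme"
    and \<mu> :: "'p \<Rightarrow> 'p \<Rightarrow> 'v \<Rightarrow> 'v \<Rightarrow> 'v" +
  fixes R :: "'p \<Rightarrow> 'v \<Rightarrow> 'v"
    and l :: 'k
  assumes weight_closed: "l \<in> carrier K"
    and R_linear: "linear_map K (A p) (A p) (R p)"
    and Rota_Baxter: "\<lbrakk>a \<in> carrier (A p); b \<in> carrier (A q)\<rbrakk>
      \<Longrightarrow> \<mu> p q (R p a) (R q b) =
          R (p * q) (\<mu> p q (R p a) b \<oplus>\<^bsub>A (p * q)\<^esub> \<mu> p q a (R q b)
                     \<oplus>\<^bsub>A (p * q)\<^esub> l \<odot>\<^bsub>A (p * q)\<^esub> \<mu> p q a b)"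

definition R_tilde ::
  "('k, 'm) ring_scheme \<Rightarrow> ('p \<Rightarrow> ('k, 'v, 'n) module_scheme) \<Rightarrow> ('p \<Rightarrow> 'v \<Rightarrow> 'v) \<Rightarrow> 'k
    \<Rightarrow> 'p \<Rightarrow> 'v \<Rightarrow> 'v" where
  "R_tilde K A R l p x = (\<ominus>\<^bsub>K\<^esub> l) \<odot>\<^bsub>A p\<^esub> x \<ominus>\<^bsub>A p\<^esub> R p x"

end

theory Submission
  imports Defs
begin

text \<open>
  With \<open>d = R a \<cdot> b + a \<cdot> R b + l (a \<cdot> b)\<close>, expanding the product of
  \<open>R_tilde a = - (l a + R a)\<close> and \<open>R_tilde b\<close> gives \<open>l d + R a \<cdot> R b\<close>, whereas
  \<open>- R_tilde c = l c + R c\<close>. So the Rota-Baxter identity yields both equations with \<open>c = d\<close>;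
  conversely, the two equations give \<open>l c = l d\<close>, hence \<open>c = d\<close>.
\<close>

lemma linear_map_closed:
  "linear_map K V W f \<Longrightarrow> x \<in> carrier V \<Longrightarrow> f x \<in> carrier W"
  by (auto simp: linear_map_def)

lemma linear_map_add:
  "linear_map K V W f \<Longrightarrow> x \<in> carrier V \<Longrightarrow> y \<in> carrier V \<Longrightarrow>
    f (x \<oplus>\<^bsub>V\<^esub> y) = f x \<oplus>\<^bsub>W\<^esub> f y"
  by (simp add: linear_map_def)

lemma linear_map_smult:
  "linear_map K V W f \<Longrightarrow> k \<in> carrier K \<Longrightarrow> x \<in> carrier V \<Longrightarrow>
    f (k \<odot>\<^bsub>V\<^esub> x) = k \<odot>\<^bsub>W\<^esub> f x"
  by (simp add: linear_map_def)

text \<open>Negation is scaling by the negative of one, so homogeneity gives the claim.\<close>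

lemma linear_map_uminus:
  assumes "module K V" "module K W" "linear_map K V W f" "x \<in> carrier V"
  shows "f (\<ominus>\<^bsub>V\<^esub> x) = \<ominus>\<^bsub>W\<^esub> f x"
proof -
  interpret V: module K V by fact
  interpret W: module K W by fact
  have "f ((\<ominus>\<^bsub>K\<^esub> \<one>\<^bsub>K\<^esub>) \<odot>\<^bsub>V\<^esub> x) = (\<ominus>\<^bsub>K\<^esub> \<one>\<^bsub>K\<^esub>) \<odot>\<^bsub>W\<^esub> f x"
    using assms by (intro linear_map_smult) auto
  then show ?thesis
    using assms(4) linear_map_closed[OF assms(3,4)] by (simp add: V.smult_l_minus W.smult_l_minus)
qed

context T_algebra
begin

lemma linear_left: "b \<in> carrier (A q) \<Longrightarrow> linear_map K (A p) (A (p * q)) (\<lambda>a. \<mu> p q a b)"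
  using \<mu>_bilinear[of p q] by (simp add: bilinear_map_def)

lemma linear_right: "a \<in> carrier (A p) \<Longrightarrow> linear_map K (A q) (A (p * q)) (\<mu> p q a)"
  using \<mu>_bilinear[of p q] by (simp add: bilinear_map_def)

lemma \<mu>_closed:
  "a \<in> carrier (A p) \<Longrightarrow> b \<in> carrier (A q) \<Longrightarrow> \<mu> p q a b \<in> carrier (A (p * q))"
  using linear_map_closed[OF linear_right] .

text \<open>Collecting both signs in front exposes \<open>R_tilde\<close> as the negative of a sum,
  the form in which signs cancel in a product.\<close>

lemma R_tilde_eq:
  assumes "l \<in> carrier K" "a \<in> carrier (A p)" "R p a \<in> carrier (A p)"
  shows "R_tilde K A R l p a = \<ominus>\<^bsub>A p\<^esub> (l \<odot>\<^bsub>A p\<^esub> a \<oplus>\<^bsub>A p\<^esub> R p a)"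
proof -
  interpret module K "A p" by (rule vector_space_component)
  show ?thesis
    using assms by (simp add: R_tilde_def M.minus_eq smult_l_minus M.minus_add)
qed

text \<open>Linearity in each argument separately pulls out one sign, and the two signs
  cancel.\<close>

lemma \<mu>_uminus_uminus:
  assumes a: "a \<in> carrier (A p)" and b: "b \<in> carrier (A q)"
  shows "\<mu> p q (\<ominus>\<^bsub>A p\<^esub> a) (\<ominus>\<^bsub>A q\<^esub> b) = \<mu> p q a b"
proof -
  interpret P: module K "A p" by (rule vector_space_component)
  interpret Q: module K "A q" by (rule vector_space_component)
  interpret PQ: module K "A (p * q)" by (rule vector_space_component)
  have "\<mu> p q (\<ominus>\<^bsub>A p\<^esub> a) (\<ominus>\<^bsub>A q\<^esub> b) = \<ominus>\<^bsub>A (p * q)\<^esub> \<mu> p q a (\<ominus>\<^bsub>A q\<^esub> b)"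
    using linear_map_uminus[OF P.module_axioms PQ.module_axioms linear_left a] b by simp
  also have "\<dots> = \<mu> p q a b"
    using linear_map_uminus[OF Q.module_axioms PQ.module_axioms linear_right b] a b
    by (simp add: \<mu>_closed)
  finally show ?thesis .
qed

text \<open>Once the signs cancel, the product of \<open>l a + R a\<close> and
  \<open>l b + R b\<close> has four terms, and three of them carry a factor \<open>l\<close>. This
  is pure bilinearity: \<open>R\<close> enters only through its two values, with no Rota-Baxter
  identity.\<close>

lemma R_tilde_product:
  assumes l: "l \<in> carrier K"
    and a: "a \<in> carrier (A p)" and Ra: "R p a \<in> carrier (A p)"
    and b: "b \<in> carrier (A q)" and Rb: "R q b \<in> carrier (A q)"
  shows "\<mu> p q (R_tilde K A R l p a) (R_tilde K A R l q b) =
    l \<odot>\<^bsub>A (p * q)\<^esub> (\<mu> p q (R p a) b \<oplus>\<^bsub>A (p * q)\<^esub> \<mu> p q a (R q b)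
      \<oplus>\<^bsub>A (p * q)\<^esub> l \<odot>\<^bsub>A (p * q)\<^esub> \<mu> p q a b) \<oplus>\<^bsub>A (p * q)\<^esub> \<mu> p q (R p a) (R q b)"
proof -
  interpret P: module K "A p" by (rule vector_space_component)
  interpret Q: module K "A q" by (rule vector_space_component)
  interpret PQ: module K "A (p * q)" by (rule vector_space_component)
  let ?v = "l \<odot>\<^bsub>A q\<^esub> b \<oplus>\<^bsub>A q\<^esub> R q b"
  \<comment> \<open>Stated for general \<open>x\<close> because it is applied with
    \<open>x = a\<close> and with \<open>x = R p a\<close>.\<close>
  have right: "\<mu> p q x ?v = l \<odot>\<^bsub>A (p * q)\<^esub> \<mu> p q x b \<oplus>\<^bsub>A (p * q)\<^esub> \<mu> p q x (R q b)"
    if "x \<in> carrier (A p)" for x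
    using that l b Rb by (simp add: linear_map_add[OF linear_right] linear_map_smult[OF linear_right])
  have "\<mu> p q (R_tilde K A R l p a) (R_tilde K A R l q b)
      = \<mu> p q (l \<odot>\<^bsub>A p\<^esub> a \<oplus>\<^bsub>A p\<^esub> R p a) ?v"
    using assms by (simp add: R_tilde_eq \<mu>_uminus_uminus)
  also have "\<dots> = l \<odot>\<^bsub>A (p * q)\<^esub> \<mu> p q a ?v \<oplus>\<^bsub>A (p * q)\<^esub> \<mu> p q (R p a) ?v"
    using assms linear_map_add[OF linear_left, of ?v q "l \<odot>\<^bsub>A p\<^esub> a" p "R p a"]
      linear_map_smult[OF linear_left, of ?v q l a p] by simp
  finally show ?thesis
    \<comment> \<open>Distributing \<open>l\<close> turns both sides into the same four summands up
      to order.\<close>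
    using assms by (simp add: right \<mu>_closed PQ.smult_r_distr PQ.M.add.m_ac)
qed

end

theorem proposition2p4:
  fixes K :: "('k, 'm) ring_scheme"
    and A :: "'p::semigroup_mult \<Rightarrow> ('k, 'v, 'n) module_scheme"
    and \<mu> :: "'p \<Rightarrow> 'p \<Rightarrow> 'v \<Rightarrow> 'v \<Rightarrow> 'v"
    and R :: "'p \<Rightarrow> 'v \<Rightarrow> 'v"
    and l :: 'k
  assumes "T_algebra K A \<mu>"
    and "\<And>p. linear_map K (A p) (A p) (R p)"
    and "l \<in> carrier K" and "l \<noteq> \<zero>\<^bsub>K\<^esub>"
    and "\<And>p c. c \<in> carrier (A p) \<Longrightarrow> l \<odot>\<^bsub>A p\<^esub> c = \<zero>\<^bsub>A p\<^esub> \<Longrightarrow> c = \<zero>\<^bsub>A p\<^esub>"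
  shows "Rota_Baxter_T_algebra K A \<mu> R l \<longleftrightarrow>
    (\<forall>p q. \<forall>a\<in>carrier (A p). \<forall>b\<in>carrier (A q). \<exists>c\<in>carrier (A (p * q)).
       \<mu> p q (R p a) (R q b) = R (p * q) c \<and>
       \<mu> p q (R_tilde K A R l p a) (R_tilde K A R l q b) =
         \<ominus>\<^bsub>A (p * q)\<^esub> R_tilde K A R l (p * q) c)"
proof -
  interpret T_algebra K A \<mu> by fact
  have R_closed: "R p a \<in> carrier (A p)" if "a \<in> carrier (A p)" for p a
    using linear_map_closed[OF assms(2) that] .
  let ?d = "\<lambda>p q a b. \<mu> p q (R p a) b \<oplus>\<^bsub>A (p * q)\<^esub> \<mu> p q a (R q b)
    \<oplus>\<^bsub>A (p * q)\<^esub> l \<odot>\<^bsub>A (p * q)\<^esub> \<mu> p q a b"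
  have d_closed: "?d p q a b \<in> carrier (A (p * q))"
    if "a \<in> carrier (A p)" "b \<in> carrier (A q)" for p q a b
  proof -
    interpret PQ: module K "A (p * q)" by (rule vector_space_component)
    show ?thesis using that assms(3) by (simp add: \<mu>_closed R_closed)
  qed
  have uminus_R_tilde:
    "\<ominus>\<^bsub>A p\<^esub> R_tilde K A R l p c = l \<odot>\<^bsub>A p\<^esub> c \<oplus>\<^bsub>A p\<^esub> R p c" if "c \<in> carrier (A p)" for p c
  proof -
    interpret P: module K "A p" by (rule vector_space_component)
    show ?thesis using that assms(3) by (simp add: R_tilde_eq R_closed)
  qed
  have product: "\<mu> p q (R_tilde K A R l p a) (R_tilde K A R l q b) =
      l \<odot>\<^bsub>A (p * q)\<^esub> ?d p q a b \<oplus>\<^bsub>A (p * q)\<^esub> \<mu> p q (R p a) (R q b)"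
    if "a \<in> carrier (A p)" "b \<in> carrier (A q)" for p q a b
    using that assms(3) by (intro R_tilde_product R_closed)
  show ?thesis
  proof
    assume "Rota_Baxter_T_algebra K A \<mu> R l"
    then interpret Rota_Baxter_T_algebra K A \<mu> R l .
    show "\<forall>p q. \<forall>a\<in>carrier (A p). \<forall>b\<in>carrier (A q). \<exists>c\<in>carrier (A (p * q)).
       \<mu> p q (R p a) (R q b) = R (p * q) c \<and>
       \<mu> p q (R_tilde K A R l p a) (R_tilde K A R l q b) =
         \<ominus>\<^bsub>A (p * q)\<^esub> R_tilde K A R l (p * q) c"
    proof (intro allI ballI)
      fix p q a b
      assume ab: "a \<in> carrier (A p)" "b \<in> carrier (A q)"
      show "\<exists>c\<in>carrier (A (p * q)). \<mu> p q (R p a) (R q b) = R (p * q) c \<and>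
        \<mu> p q (R_tilde K A R l p a) (R_tilde K A R l q b) =
          \<ominus>\<^bsub>A (p * q)\<^esub> R_tilde K A R l (p * q) c"
        \<comment> \<open>The Rota-Baxter identity is the first equation. It also replaces the last
          summand of \<open>product\<close> by \<open>R (p * q)\<close> of the witness, which gives
          the right-hand side of \<open>uminus_R_tilde\<close>.\<close>
        using product[OF ab] uminus_R_tilde[OF d_closed[OF ab]] Rota_Baxter[OF ab] d_closed[OF ab]
        by (intro bexI[of _ "?d p q a b"]) simp_all
    qed
  next
    assume ex: "\<forall>p q. \<forall>a\<in>carrier (A p). \<forall>b\<in>carrier (A q). \<exists>c\<in>carrier (A (p * q)).
       \<mu> p q (R p a) (R q b) = R (p * q) c \<and>
       \<mu> p q (R_tilde K A R l p a) (R_tilde K A R l q b) =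
         \<ominus>\<^bsub>A (p * q)\<^esub> R_tilde K A R l (p * q) c"
    \<comment> \<open>Linearity of \<open>R\<close> and membership of \<open>l\<close> in the field
      are given, so only the Rota-Baxter identity is left to prove.\<close>
    have "\<mu> p q (R p a) (R q b) = R (p * q) (?d p q a b)"
      if ab: "a \<in> carrier (A p)" "b \<in> carrier (A q)" for p q a b
    proof -
      interpret PQ: module K "A (p * q)" by (rule vector_space_component)
      let ?e = "?d p q a b"
      note e = d_closed[OF ab]
      obtain c where c: "c \<in> carrier (A (p * q))" and Rc: "\<mu> p q (R p a) (R q b) = R (p * q) c"
        and tilde: "\<mu> p q (R_tilde K A R l p a) (R_tilde K A R l q b) =
          \<ominus>\<^bsub>A (p * q)\<^esub> R_tilde K A R l (p * q) c"
        using ex ab by blast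
      \<comment> \<open>Rewriting the last summand of \<open>product\<close> by \<open>Rc\<close>
        leaves \<open>R (p * q) c\<close> on both sides, ready to be cancelled.\<close>
      have "l \<odot>\<^bsub>A (p * q)\<^esub> ?e \<oplus>\<^bsub>A (p * q)\<^esub> R (p * q) c =
          l \<odot>\<^bsub>A (p * q)\<^esub> c \<oplus>\<^bsub>A (p * q)\<^esub> R (p * q) c"
        using tilde unfolding product[OF ab] uminus_R_tilde[OF c] Rc .
      then have "l \<odot>\<^bsub>A (p * q)\<^esub> ?e = l \<odot>\<^bsub>A (p * q)\<^esub> c"
        using PQ.M.add.right_cancel PQ.smult_closed R_closed assms(3) c e by metis
      \<comment> \<open>The assumption on zero divisors concerns one element killed by
        \<open>l\<close>, hence the passage to the difference.\<close>
      then have "l \<odot>\<^bsub>A (p * q)\<^esub> (?e \<ominus>\<^bsub>A (p * q)\<^esub> c) = \<zero>\<^bsub>A (p * q)\<^esub>"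
        using assms(3) c e
        by (simp only: PQ.M.minus_eq PQ.smult_r_distr PQ.smult_r_minus PQ.M.a_inv_closed
            PQ.M.r_neg PQ.smult_closed)
      then have "?e \<ominus>\<^bsub>A (p * q)\<^esub> c = \<zero>\<^bsub>A (p * q)\<^esub>"
        using assms(5) PQ.M.minus_closed[OF e c] by blast
      \<comment> \<open>Additive inverses are unique: \<open>?e\<close> is the inverse of the
        negative of \<open>c\<close>, which is \<open>c\<close> itself.\<close>
      then have "?e = c"
        using PQ.M.minus_equality[of ?e "\<ominus>\<^bsub>A (p * q)\<^esub> c"] e c by (simp add: PQ.M.minus_eq)
      then show ?thesis
        using Rc by simp
    qed
    with assms(2,3) show "Rota_Baxter_T_algebra K A \<mu> R l"
      by unfold_locales
  qed
qed

end
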